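(* Let $0\le\beta\le1$ and consider the two-stage sequentially blocked trees $T_k$ with $k$ leaves and block size $b=k^\beta$. Let $\alpha_\tau(\beta)=\frac12\lim_{k\to\infty}\frac{\log\Lambda_1(T_k)}{\log k}$ be the exponent of this family. Then $$\alpha_\tau(\beta)=\frac12\max(2-\beta,\,1+\beta).$$ The two branches meet at $\beta=1/2$, where $b\asymp\sqrt{k}$ and $\alpha_\tau=3/4$.
   Context: For a full binary tree $T$ (every internal node has exactly two children), $\operatorname{int}(T)$ is the set of internal nodes, $\mathcal L(v)$ the set of leaves below $v$, and $\Lambda_1(T)=\sum_{v\in\operatorname{int}(T)}|\mathcal L(v)|$. Two-stage sequential blocking with block size $b$: the $k$ leaves are split into consecutive blocks of $b$ leaves (the final block may be shorter if $b$ does not divide $k$); the leaves in each block are summed sequentially (one at a time into a running sum), and then the block totals are summed sequentially in order. The block size is an integer between $1$ and $k$; "$b=k^\beta$" is understood up to integer rounding, i.e. $b\asymp k^\beta$. Here $f\asymp g$ means $c\,g(k)\le f(k)\le C\,g(k)$ for positive constants $c,C$ independent of $k$. *)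

theory Defs
  imports Complex_Main "HOL-Library.Sublist" "HOL-Library.Landau_Symbols"
begin

datatype 'a full_tree = Leaf 'a | Node "'a full_tree" "'a full_tree"

text \<open>
  Nodes are identified by their paths from the root (\<^term>\<open>False\<close> is left, \<^term>\<open>True\<close> is right),
  so that distinct nodes carrying equal subtrees are counted separately.
\<close>

primrec internal_nodes :: "'a full_tree \<Rightarrow> bool list set" where
  "internal_nodes (Leaf x) = {}"
| "internal_nodes (Node l r) =
     insert [] ((#) False ` internal_nodes l \<union> (#) True ` internal_nodes r)"

primrec leaf_nodes :: "'a full_tree \<Rightarrow> bool list set" where
  "leaf_nodes (Leaf x) = {[]}"
| "leaf_nodes (Node l r) = (#) False ` leaf_nodes l \<union> (#) True ` leaf_nodes r"

definition leaves_below :: "'a full_tree \<Rightarrow> bool list \<Rightarrow> bool list set" where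
  "leaves_below T v = {w \<in> leaf_nodes T. prefix v w}"

definition Lambda1 :: "'a full_tree \<Rightarrow> nat" where
  "Lambda1 T = (\<Sum>v\<in>internal_nodes T. card (leaves_below T v))"

text \<open>
  Sequential summation: the running sum starts as the first summand, so \<open>m\<close> summands need
  \<open>m - 1\<close> additions. There is no tree for the empty list.
\<close>

definition seq_tree :: "'a full_tree list \<Rightarrow> 'a full_tree" where
  "seq_tree ts = foldl Node (hd ts) (tl ts)"

text \<open>The last block is shorter when \<open>b\<close> does not divide the length; \<open>b = 0\<close> is a dummy case.\<close>

function blocks :: "nat \<Rightarrow> 'a list \<Rightarrow> 'a list list" where
  "blocks b xs = (if b = 0 \<or> xs = [] then [] else take b xs # blocks b (drop b xs))"
  by pat_completeness auto
termination
  by (relation "measure (\<lambda>(b, xs). length xs)") auto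

declare blocks.simps [simp del]

text \<open>Leaves are labelled by the indices \<open>0, \<dots>, k - 1\<close> of the summands; meaningful for \<open>1 \<le> b \<le> k\<close>.\<close>

definition two_stage_tree :: "nat \<Rightarrow> nat \<Rightarrow> nat full_tree" where
  "two_stage_tree b k = seq_tree (map (\<lambda>xs. seq_tree (map Leaf xs)) (blocks b [0..<k]))"

definition log_ratio :: "(nat \<Rightarrow> 'a full_tree) \<Rightarrow> nat \<Rightarrow> real" where
  "log_ratio T k = ln (real (Lambda1 (T k))) / ln (real k)"

text \<open>Only meaningful if \<^term>\<open>log_ratio T\<close> converges.\<close>

definition tree_exponent :: "(nat \<Rightarrow> 'a full_tree) \<Rightarrow> real" where
  "tree_exponent T = 1 / 2 * lim (log_ratio T)"

end

theory Submission
  imports Defs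
begin

text \<open>
  Up to constant factors, \<open>\<Lambda>\<^sub>1\<close> is \<open>k b + k\<^sup>2 / b\<close>: each of the about \<open>k / b\<close> blocks
  contributes about \<open>b\<^sup>2\<close>, and the outer sum has about \<open>k / b\<close> nodes, typically with order \<open>k\<close>
  leaves below them. After taking logarithms, the sum becomes a maximum, and
  \<open>ln b / ln k \<longlonglongrightarrow> \<beta>\<close> gives the exponent \<open>max (2 - \<beta>) (1 + \<beta>)\<close>.
\<close>

section \<open>Leaf counts and the recursion for \<open>Lambda1\<close>\<close>

abbreviation leaf_count :: "'a full_tree \<Rightarrow> nat" where
  "leaf_count T \<equiv> card (leaf_nodes T)"

lemma finite_leaf_nodes [simp]: "finite (leaf_nodes T)"
  by (induction T) auto

lemma finite_internal_nodes [simp]: "finite (internal_nodes T)"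
  by (induction T) auto

lemma leaf_count_Node [simp]: "leaf_count (Node l r) = leaf_count l + leaf_count r"
  by (auto simp: card_image intro!: card_Un_disjoint[THEN trans])

declare leaf_nodes.simps(2) [simp del]

lemma Lambda1_Leaf [simp]: "Lambda1 (Leaf x) = 0"
  by (simp add: Lambda1_def)

text \<open>The root has every leaf of both subtrees below it. Any other internal node lies in one
  subtree, and passing to the whole tree only prefixes its path and those of its leaves with one
  bit, so its contribution is unchanged.\<close>

lemma Lambda1_Node [simp]:
  "Lambda1 (Node l r) = Lambda1 l + Lambda1 r + leaf_count l + leaf_count r"
proof -
  have root: "leaves_below (Node l r) [] = leaf_nodes (Node l r)"
    by (simp add: leaves_below_def)
  have left: "leaves_below (Node l r) (False # v) = (#) False ` leaves_below l v" for v
    by (auto simp: leaves_below_def leaf_nodes.simps)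
  have right: "leaves_below (Node l r) (True # v) = (#) True ` leaves_below r v" for v
    by (auto simp: leaves_below_def leaf_nodes.simps)
  have "Lambda1 (Node l r) = leaf_count (Node l r)
      + (\<Sum>v\<in>(#) False ` internal_nodes l \<union> (#) True ` internal_nodes r.
          card (leaves_below (Node l r) v))"
    unfolding Lambda1_def internal_nodes.simps by (subst sum.insert) (auto simp: root)
  also have "\<dots> = leaf_count (Node l r)
      + (\<Sum>v\<in>(#) False ` internal_nodes l. card (leaves_below (Node l r) v))
      + (\<Sum>v\<in>(#) True ` internal_nodes r. card (leaves_below (Node l r) v))"
    by (subst sum.union_disjoint) auto
  also have "\<dots> = leaf_count (Node l r) + Lambda1 l + Lambda1 r"
    by (simp add: sum.reindex left right card_image Lambda1_def)
  finally show ?thesis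
    by simp
qed

section \<open>Sequential sums of arbitrary trees\<close>

lemma leaf_count_foldl_Node:
  "leaf_count (foldl Node t ts) = leaf_count t + (\<Sum>u\<leftarrow>ts. leaf_count u)"
  by (induction ts arbitrary: t) simp_all

lemma leaf_count_seq_tree:
  assumes "ts \<noteq> []"
  shows "leaf_count (seq_tree ts) = (\<Sum>u\<leftarrow>ts. leaf_count u)"
  using assms by (cases ts) (simp_all add: seq_tree_def leaf_count_foldl_Node)

text \<open>Each entry of \<open>ts\<close> creates one new internal node, and none of these has
  more leaves below it than the final tree has in total.\<close>

lemma Lambda1_foldl_Node_le:
  "Lambda1 (foldl Node t ts)
    \<le> Lambda1 t + (\<Sum>u\<leftarrow>ts. Lambda1 u) + length ts * (leaf_count t + (\<Sum>u\<leftarrow>ts. leaf_count u))"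
proof (induction ts arbitrary: t)
  case (Cons a ts)
  from Cons.IH[of "Node t a"] show ?case
    by (simp add: algebra_simps)
qed simp

text \<open>The factor \<open>length ts\<close> exceeds the number of additions by one; this slack
  avoids subtraction on naturals.\<close>

lemma Lambda1_seq_tree_le:
  assumes "ts \<noteq> []"
  shows "Lambda1 (seq_tree ts)
    \<le> (\<Sum>u\<leftarrow>ts. Lambda1 u) + length ts * (\<Sum>u\<leftarrow>ts. leaf_count u)"
proof (cases ts)
  case (Cons t us)
  then show ?thesis
    using Lambda1_foldl_Node_le[of t us] by (simp add: seq_tree_def)
qed (use assms in simp)

text \<open>
  Appending a summand with \<open>m \<le> B\<close> leaves to a running sum with \<open>s\<close> leaves costs \<open>s + m\<close>, while
  \<open>(s + m)\<^sup>2 - s\<^sup>2 \<le> 2 * B * (s + m)\<close>; so the cost telescopes.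
\<close>

lemma Lambda1_foldl_Node_ge:
  assumes "\<And>u. u \<in> set ts \<Longrightarrow> leaf_count u \<le> B"
  shows "(leaf_count t + (\<Sum>u\<leftarrow>ts. leaf_count u))\<^sup>2 + 2 * B * (Lambda1 t + (\<Sum>u\<leftarrow>ts. Lambda1 u))
    \<le> (leaf_count t)\<^sup>2 + 2 * B * Lambda1 (foldl Node t ts)"
  using assms
proof (induction ts arbitrary: t)
  case (Cons a ts)
  define s where "s = leaf_count t"
  define m where "m = leaf_count a"
  have "m * (2 * s + m) \<le> B * (2 * s + 2 * m)"
    using Cons.prems[of a] by (intro mult_mono) (auto simp: m_def)
  then have step: "(s + m)\<^sup>2 \<le> s\<^sup>2 + 2 * B * (s + m)"
    by (simp add: power2_eq_square algebra_simps)
  have "(s + m + (\<Sum>u\<leftarrow>ts. leaf_count u))\<^sup>2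
      + 2 * B * (Lambda1 t + Lambda1 a + s + m + (\<Sum>u\<leftarrow>ts. Lambda1 u))
    \<le> (s + m)\<^sup>2 + 2 * B * Lambda1 (foldl Node (Node t a) ts)"
    using Cons.IH[of "Node t a"] Cons.prems by (simp add: s_def m_def)
  with step show ?case
    by (simp add: algebra_simps flip: s_def m_def)
qed simp

text \<open>The first summand starts the running sum without an addition, so the telescoping begins
  at the square of its leaf count; the term \<open>B\<^sup>2\<close> on the right accounts for this
  loss.\<close>

lemma Lambda1_seq_tree_ge:
  assumes "ts \<noteq> []" "\<And>u. u \<in> set ts \<Longrightarrow> leaf_count u \<le> B"
  shows "(\<Sum>u\<leftarrow>ts. leaf_count u)\<^sup>2 + 2 * B * (\<Sum>u\<leftarrow>ts. Lambda1 u)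
    \<le> B\<^sup>2 + 2 * B * Lambda1 (seq_tree ts)"
proof (cases ts)
  case (Cons t us)
  have "(leaf_count t)\<^sup>2 \<le> B\<^sup>2"
    using assms(2)[of t] Cons by (intro power_mono) auto
  moreover have "leaf_count u \<le> B" if "u \<in> set us" for u
    using assms(2) Cons that by simp
  moreover from this have "(leaf_count t + (\<Sum>u\<leftarrow>us. leaf_count u))\<^sup>2
      + 2 * B * (Lambda1 t + (\<Sum>u\<leftarrow>us. Lambda1 u))
    \<le> (leaf_count t)\<^sup>2 + 2 * B * Lambda1 (seq_tree ts)"
    using Lambda1_foldl_Node_ge[of us B t] Cons by (simp add: seq_tree_def)
  ultimately show ?thesis
    unfolding Cons list.map sum_list.Cons by linarith
qed (use assms in simp)

section \<open>Sequential sums of single leaves\<close>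

lemma leaf_count_seq_tree_Leaf:
  assumes "xs \<noteq> []"
  shows "leaf_count (seq_tree (map Leaf xs)) = length xs"
  using assms by (simp add: leaf_count_seq_tree o_def sum_list_triv)

lemma Lambda1_seq_tree_Leaf_le:
  assumes "xs \<noteq> []"
  shows "Lambda1 (seq_tree (map Leaf xs)) \<le> length xs * length xs"
  using Lambda1_seq_tree_le[of "map Leaf xs"] assms by (simp add: o_def sum_list_triv)

text \<open>The telescoped bound with \<open>B = 1\<close> has an additive 1, which the constant 4
  in place of 2 absorbs once there are two leaves. A single leaf has \<open>Lambda1\<close> zero, so
  length one must be excluded.\<close>

lemma Lambda1_seq_tree_Leaf_ge:
  assumes "length xs \<ge> 2"
  shows "length xs * length xs \<le> 4 * Lambda1 (seq_tree (map Leaf xs))"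
proof -
  have "xs \<noteq> []"
    using assms by auto
  moreover have "leaf_count u \<le> 1" if "u \<in> set (map Leaf xs)" for u
    using that by auto
  ultimately have "(length xs)\<^sup>2 \<le> 1 + 2 * Lambda1 (seq_tree (map Leaf xs))"
    using Lambda1_seq_tree_ge[of "map Leaf xs" 1] by (simp add: o_def sum_list_triv)
  moreover have "2 * 2 \<le> length xs * length xs"
    using assms by (intro mult_mono) auto
  ultimately show ?thesis
    by (simp add: power2_eq_square)
qed

section \<open>Splitting into blocks and the total cost of the blocks\<close>

lemma blocks_Nil [simp]: "blocks b [] = []"
  by (simp add: blocks.simps)

lemma blocks_nonempty:
  assumes "b \<noteq> 0" "xs \<noteq> []"
  shows "blocks b xs = take b xs # blocks b (drop b xs)"
  using assms by (subst blocks.simps) simp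

lemma blocks_eq_Nil_iff:
  assumes "b \<noteq> 0"
  shows "blocks b xs = [] \<longleftrightarrow> xs = []"
  using assms by (subst blocks.simps) simp

lemma set_blocksD:
  assumes "ys \<in> set (blocks b xs)"
  shows "ys \<noteq> []" and "length ys \<le> b"
proof -
  from assms have "ys \<noteq> [] \<and> length ys \<le> b"
    by (induction b xs rule: blocks.induct) (subst (asm) (2) blocks.simps, auto split: if_splits)
  then show "ys \<noteq> []" and "length ys \<le> b"
    by auto
qed

lemma sum_length_blocks:
  assumes "b \<noteq> 0"
  shows "(\<Sum>ys\<leftarrow>blocks b xs. length ys) = length xs"
  using assms
proof (induction b xs rule: blocks.induct)
  case (1 b xs)
  then show ?case
    by (cases "xs = []") (simp_all add: blocks_nonempty)
qed

lemma sum_leaf_count_blocks: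
  assumes "b \<noteq> 0"
  shows "(\<Sum>ys\<leftarrow>blocks b xs. leaf_count (seq_tree (map Leaf ys))) = length xs"
proof -
  have "(\<Sum>ys\<leftarrow>blocks b xs. leaf_count (seq_tree (map Leaf ys)))
      = (\<Sum>ys\<leftarrow>blocks b xs. length ys)"
    using set_blocksD(1)
    by (intro arg_cong[of _ _ sum_list] map_cong refl leaf_count_seq_tree_Leaf)
  then show ?thesis
    using assms by (simp add: sum_length_blocks)
qed

text \<open>All blocks except possibly the last have exactly \<open>b\<close> entries; the summand
  \<open>b\<close> on the right pays for a short last block.\<close>

lemma length_blocks_le:
  assumes "b \<noteq> 0"
  shows "b * length (blocks b xs) \<le> length xs + b"
  using assms
proof (induction b xs rule: blocks.induct)
  case (1 b xs)
  show ?case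
  proof (cases "length xs \<le> b")
    case True
    then show ?thesis
      using 1 by (cases "xs = []") (simp_all add: blocks_nonempty)
  next
    case False
    then have "xs \<noteq> []" by auto
    with 1 False show ?thesis
      by (simp add: blocks_nonempty)
  qed
qed

text \<open>A block of length m costs at most m * m, hence at most b * m, and the block lengths add
  up to \<open>length xs\<close>.\<close>

lemma sum_Lambda1_blocks_le:
  assumes "b \<noteq> 0"
  shows "(\<Sum>ys\<leftarrow>blocks b xs. Lambda1 (seq_tree (map Leaf ys))) \<le> b * length xs"
proof -
  have "(\<Sum>ys\<leftarrow>blocks b xs. Lambda1 (seq_tree (map Leaf ys)))
      \<le> (\<Sum>ys\<leftarrow>blocks b xs. b * length ys)"
  proof (rule sum_list_mono)
    fix ys assume ys: "ys \<in> set (blocks b xs)"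
    have "Lambda1 (seq_tree (map Leaf ys)) \<le> length ys * length ys"
      using set_blocksD(1)[OF ys] by (rule Lambda1_seq_tree_Leaf_le)
    also have "\<dots> \<le> b * length ys"
      using set_blocksD(2)[OF ys] by simp
    finally show "Lambda1 (seq_tree (map Leaf ys)) \<le> b * length ys" .
  qed
  then show ?thesis
    using assms by (simp add: sum_list_const_mult sum_length_blocks)
qed

text \<open>Each block before the last is full and costs at least a quarter of \<open>b * b\<close>.
  The last block may be a single leaf of cost zero, so its share is covered by the error term
  \<open>b * b\<close>.\<close>

lemma sum_Lambda1_blocks_ge:
  assumes "2 \<le> b"
  shows "b * length xs \<le> 4 * (\<Sum>ys\<leftarrow>blocks b xs. Lambda1 (seq_tree (map Leaf ys))) + b * b"
  using assms
proof (induction b xs rule: blocks.induct)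
  case (1 b xs)
  show ?case
  proof (cases "length xs \<le> b")
    case True
    then show ?thesis
      by (simp add: trans_le_add2)
  next
    case False
    then have ne: "xs \<noteq> []" by auto
    have IH: "b * length (drop b xs)
        \<le> 4 * (\<Sum>ys\<leftarrow>blocks b (drop b xs). Lambda1 (seq_tree (map Leaf ys))) + b * b"
      using 1 ne by simp
    have "b * b \<le> 4 * Lambda1 (seq_tree (map Leaf (take b xs)))"
      using Lambda1_seq_tree_Leaf_ge[of "take b xs"] 1 False by simp
    moreover have "b * length xs = b * b + b * length (drop b xs)"
      using False by (simp flip: distrib_left)
    ultimately show ?thesis
      using IH 1 ne by (simp add: blocks_nonempty)
  qed
qed

section \<open>Two-sided bounds for the two-stage tree\<close>

lemma Lambda1_two_stage_tree_le:
  assumes "1 \<le> b" "b \<le> k"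
  shows "b * Lambda1 (two_stage_tree b k) \<le> b * (b * k) + 2 * (k * k)"
proof -
  define bs where "bs = blocks b [0..<k]"
  have ne: "bs \<noteq> []"
    using assms by (simp add: bs_def blocks_eq_Nil_iff)
  have count: "(\<Sum>ys\<leftarrow>bs. leaf_count (seq_tree (map Leaf ys))) = k"
    using assms by (simp add: bs_def sum_leaf_count_blocks)
  have "Lambda1 (two_stage_tree b k)
      \<le> (\<Sum>ys\<leftarrow>bs. Lambda1 (seq_tree (map Leaf ys))) + length bs * k"
    using Lambda1_seq_tree_le[of "map (\<lambda>xs. seq_tree (map Leaf xs)) bs"] ne count
    by (simp add: two_stage_tree_def o_def flip: bs_def)
  also have "\<dots> \<le> b * k + length bs * k"
    using sum_Lambda1_blocks_le[of b "[0..<k]"] assms by (simp add: bs_def)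
  finally have "b * Lambda1 (two_stage_tree b k) \<le> b * (b * k + length bs * k)"
    by simp
  \<comment> \<open>Here \<open>b \<le> k\<close> turns the bound k + b into 2 * k. Multiplying
    everything by \<open>b\<close> avoids the rounding in k / b.\<close>
  moreover have "(b * length bs) * k \<le> (2 * k) * k"
    using length_blocks_le[of b "[0..<k]"] assms by (intro mult_right_mono) (auto simp: bs_def)
  ultimately show ?thesis
    unfolding distrib_left mult.assoc by linarith
qed

text \<open>The first bound reflects the running sum over the block totals, the second the work
  inside the blocks. For \<open>k = 1\<close> the tree is a leaf and both would fail.\<close>

lemma Lambda1_two_stage_tree_ge:
  assumes "1 \<le> b" "b \<le> k" "2 \<le> k"
  shows "k * k \<le> 8 * b * Lambda1 (two_stage_tree b k)"
    and "b * k \<le> 8 * Lambda1 (two_stage_tree b k)"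
proof -
  define bs where "bs = blocks b [0..<k]"
  define L where "L = Lambda1 (two_stage_tree b k)"
  define F where "F = (\<Sum>ys\<leftarrow>bs. Lambda1 (seq_tree (map Leaf ys)))"
  have ne: "bs \<noteq> []"
    using assms by (simp add: bs_def blocks_eq_Nil_iff)
  have count: "(\<Sum>ys\<leftarrow>bs. leaf_count (seq_tree (map Leaf ys))) = k"
    using assms by (simp add: bs_def sum_leaf_count_blocks)
  have bound: "leaf_count (seq_tree (map Leaf ys)) \<le> b" if "ys \<in> set bs" for ys
    using set_blocksD[of ys b] that by (simp add: bs_def leaf_count_seq_tree_Leaf)
  have outer: "k * k + 2 * b * F \<le> b * b + 2 * b * L"
    using Lambda1_seq_tree_ge[of "map (\<lambda>xs. seq_tree (map Leaf xs)) bs" b] ne count bound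
    by (auto simp: two_stage_tree_def o_def F_def L_def power2_eq_square simp flip: bs_def)
  have "k * k \<le> 8 * b * L \<and> b * k \<le> 8 * L"
  proof (cases "b = 1")
    \<comment> \<open>One-leaf blocks cost nothing, so \<open>F\<close> cannot help;
      \<open>outer\<close> alone suffices, as \<open>k * k\<close> is at least 4 and at least
      \<open>k\<close>.\<close>
    case True
    have "2 * 2 \<le> k * k"
      using assms by (intro mult_mono) auto
    moreover have "k \<le> k * k"
      by (rule le_square)
    moreover have "k * k + 2 * F \<le> 1 + 2 * L"
      using outer True by simp
    ultimately show ?thesis
      unfolding True mult_1_left mult_1_right by linarith
  next
    case False
    then have "2 \<le> b"
      using assms by simp
    \<comment> \<open>The first block is full because \<open>b \<le> k\<close>. Its cost alone
      absorbs the error terms \<open>b * b\<close> of both lower bounds.\<close>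
    have "b * b \<le> 4 * F"
    proof -
      have "bs = take b [0..<k] # blocks b (drop b [0..<k])"
        unfolding bs_def using assms by (intro blocks_nonempty) auto
      then show ?thesis
        using Lambda1_seq_tree_Leaf_ge[of "take b [0..<k]"] assms \<open>2 \<le> b\<close>
        by (simp add: F_def)
    qed
    moreover have "b * k \<le> 4 * F + b * b"
      using sum_Lambda1_blocks_ge[OF \<open>2 \<le> b\<close>, of "[0..<k]"] by (simp add: F_def bs_def)
    moreover have "F \<le> L"
    proof -
      have "b * b \<le> k * k"
        using assms by (intro mult_mono) auto
      with outer have "2 * b * F \<le> 2 * b * L"
        by linarith
      then show ?thesis
        using assms by simp
    qed
    \<comment> \<open>This brings the \<open>b * b\<close> of \<open>outer\<close> into the form of
      its other terms \<open>b * F\<close> and \<open>b * L\<close>.\<close>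
    moreover have "b * b \<le> b * (4 * F)"
    proof -
      have "b \<le> 4 * F"
        using le_square[of b] \<open>b * b \<le> 4 * F\<close> by (rule order_trans)
      then show ?thesis
        by (rule mult_le_mono2)
    qed
    moreover have "b * F \<le> b * L"
      using \<open>F \<le> L\<close> by simp
    ultimately show ?thesis
      using outer unfolding mult.assoc mult.left_commute[of b 4 F] by linarith
  qed
  then show "k * k \<le> 8 * b * Lambda1 (two_stage_tree b k)"
    and "b * k \<le> 8 * Lambda1 (two_stage_tree b k)"
    by (simp_all add: L_def)
qed

section \<open>From bounds on \<open>Lambda1\<close> to bounds on the logarithmic ratio\<close>

lemma log_ratio_two_stage_tree_bounds:
  assumes "1 \<le> b" "b \<le> k" "2 \<le> k" and T: "T k = two_stage_tree b k"
  defines "u \<equiv> ln (real b) / ln (real k)"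
  shows "max (2 - u) (1 + u) - ln 8 / ln (real k) \<le> log_ratio T k"
    and "log_ratio T k \<le> max (2 - u) (1 + u) + ln 3 / ln (real k)"
proof -
  define L where "L = real (Lambda1 (two_stage_tree b k))"
  define B where "B = real b"
  define K where "K = real k"
  have pos: "B \<ge> 1" "K \<ge> 2" "ln K > 0"
    using assms by (auto simp: B_def K_def)
  have lower: "K * K \<le> 8 * B * L" "B * K \<le> 8 * L"
    using Lambda1_two_stage_tree_ge[OF assms(1-3), THEN of_nat_mono[where 'a = real]]
    by (simp_all add: L_def B_def K_def)
  have upper: "B * L \<le> B * (B * K) + 2 * (K * K)"
    using Lambda1_two_stage_tree_le[OF assms(1,2), THEN of_nat_mono[where 'a = real]]
    by (simp add: L_def B_def K_def)
  have "B * K > 0"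
    using pos by simp
  with lower(2) have "L > 0"
    by linarith
  \<comment> \<open>So B is K to the power \<open>u\<close>: up to constants, K * K / B and B * K
    are K to the powers 2 - u and 1 + u.\<close>
  have uK: "ln B = u * ln K"
    using pos by (simp add: u_def B_def K_def)
  have lr: "log_ratio T k = ln L / ln K"
    by (simp add: log_ratio_def T L_def K_def)
  have "ln (K * K) \<le> ln (8 * B * L)"
    using lower(1) pos \<open>L > 0\<close> by (subst ln_le_cancel_iff) auto
  then have 1: "(2 - u) * ln K - ln 8 \<le> ln L"
    using pos \<open>L > 0\<close> by (simp add: ln_mult uK algebra_simps)
  have "ln (B * K) \<le> ln (8 * L)"
    using lower(2) pos \<open>L > 0\<close> by (subst ln_le_cancel_iff) auto
  then have 2: "(1 + u) * ln K - ln 8 \<le> ln L"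
    using pos \<open>L > 0\<close> by (simp add: ln_mult uK algebra_simps)
  from 1 2 have "max (2 - u) (1 + u) * ln K - ln 8 \<le> ln L"
    by (simp add: max_def)
  then show "max (2 - u) (1 + u) - ln 8 / ln (real k) \<le> log_ratio T k"
    using pos by (simp add: lr pos_le_divide_eq left_diff_distrib flip: K_def)
  have "ln L \<le> max (2 - u) (1 + u) * ln K + ln 3"
  \<comment> \<open>The split decides which of K * K / B and B * K is larger. Replacing the smaller
    by the larger in \<open>upper\<close>, with coefficients 1 and 2, gives the constant 3 either
    way.\<close>
  proof (cases "B * B \<le> K")
    case True
    then have "B * (B * K) \<le> K * K"
      using pos by (simp flip: mult.assoc)
    with upper have "B * L \<le> 3 * (K * K)"
      by linarith
    then have "ln (B * L) \<le> ln (3 * (K * K))"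
      using pos \<open>L > 0\<close> by (subst ln_le_cancel_iff) auto
    then have "ln L \<le> (2 - u) * ln K + ln 3"
      using pos \<open>L > 0\<close> by (simp add: ln_mult uK algebra_simps)
    moreover have "(2 - u) * ln K \<le> max (2 - u) (1 + u) * ln K"
      using pos by (intro mult_right_mono) auto
    ultimately show ?thesis by linarith
  next
    case False
    then have "K * K \<le> B * (B * K)"
      using pos by (simp flip: mult.assoc)
    with upper have "B * L \<le> B * (3 * (B * K))"
      by linarith
    then have "L \<le> 3 * (B * K)"
      using pos by simp
    then have "ln L \<le> ln (3 * (B * K))"
      using pos \<open>L > 0\<close> by (subst ln_le_cancel_iff) auto
    then have "ln L \<le> (1 + u) * ln K + ln 3"
      using pos \<open>L > 0\<close> by (simp add: ln_mult uK algebra_simps)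
    moreover have "(1 + u) * ln K \<le> max (2 - u) (1 + u) * ln K"
      using pos by (intro mult_right_mono) auto
    ultimately show ?thesis by linarith
  qed
  then show "log_ratio T k \<le> max (2 - u) (1 + u) + ln 3 / ln (real k)"
    using pos by (simp add: lr pos_divide_le_eq distrib_right flip: K_def)
qed

section \<open>Passage to the limit\<close>

lemma tendsto_const_over_ln: "(\<lambda>k. c / ln (real k)) \<longlonglongrightarrow> 0"
  by (intro tendsto_divide_0[OF tendsto_const] filterlim_at_top_imp_at_infinity
      filterlim_compose[OF ln_at_top filterlim_real_sequentially])

text \<open>The constants of the Theta bound shift \<open>ln (f k)\<close> by bounded amounts only,
  which vanish after division by \<open>ln (real k)\<close>.\<close>

lemma ln_over_ln_tendsto_of_bigtheta_powr:
  fixes f :: "nat \<Rightarrow> real"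
  assumes "f \<in> \<Theta>(\<lambda>k. real k powr e)" and f_pos: "eventually (\<lambda>k. f k > 0) sequentially"
  shows "(\<lambda>k. ln (f k) / ln (real k)) \<longlonglongrightarrow> e"
proof -
  from assms(1) obtain C where C: "C > 0"
    and up: "eventually (\<lambda>k. norm (f k) \<le> C * norm (real k powr e)) sequentially"
    by (auto elim!: landau_o.bigE dest: bigthetaD1)
  from assms(1) obtain c where c: "c > 0"
    and low: "eventually (\<lambda>k. norm (f k) \<ge> c * norm (real k powr e)) sequentially"
    by (auto elim!: landau_omega.bigE dest: bigthetaD2)
  have lim: "(\<lambda>k. e + a / ln (real k)) \<longlonglongrightarrow> e" for a
    using tendsto_add[OF tendsto_const[of e] tendsto_const_over_ln[of a]] by simp
  show ?thesis
  proof (rule tendsto_sandwich[OF _ _ lim[of "ln c"] lim[of "ln C"]])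
    show "eventually (\<lambda>k. e + ln c / ln (real k) \<le> ln (f k) / ln (real k)) sequentially"
      using low f_pos eventually_ge_at_top[of 2]
    proof eventually_elim
      case (elim k)
      then have "ln (c * real k powr e) \<le> ln (f k)"
        using c by (subst ln_le_cancel_iff) auto
      then show ?case
        using c elim by (simp add: ln_mult ln_powr pos_le_divide_eq distrib_right)
    qed
    show "eventually (\<lambda>k. ln (f k) / ln (real k) \<le> e + ln C / ln (real k)) sequentially"
      using up f_pos eventually_ge_at_top[of 2]
    proof eventually_elim
      case (elim k)
      then have "ln (f k) \<le> ln (C * real k powr e)"
        using C by (subst ln_le_cancel_iff) auto
      then show ?case
        using C elim by (simp add: ln_mult ln_powr pos_divide_le_eq distrib_right)
    qed
  qed
qed

theorem proposition3p3:
  fixes \<beta> :: real and b :: "nat \<Rightarrow> nat" and T :: "nat \<Rightarrow> nat full_tree"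
  assumes "0 \<le> \<beta>" and "\<beta> \<le> 1"
    and "\<And>k. 1 \<le> k \<Longrightarrow> 1 \<le> b k \<and> b k \<le> k"
    and "(\<lambda>k. real (b k)) \<in> \<Theta>(\<lambda>k. real k powr \<beta>)"
    and "\<And>k. 1 \<le> k \<Longrightarrow> T k = two_stage_tree (b k) k"
  shows "convergent (log_ratio T)
    \<and> tree_exponent T = 1 / 2 * max (2 - \<beta>) (1 + \<beta>)
    \<and> (2 - \<beta> = 1 + \<beta> \<longleftrightarrow> \<beta> = 1 / 2)
    \<and> (\<beta> = 1 / 2 \<longrightarrow>
         (\<lambda>k. real (b k)) \<in> \<Theta>(\<lambda>k. sqrt (real k)) \<and> tree_exponent T = 3 / 4)"
proof -
  define u where "u = (\<lambda>k. ln (real (b k)) / ln (real k))"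
  have "u \<longlonglongrightarrow> \<beta>"
    unfolding u_def
  proof (rule ln_over_ln_tendsto_of_bigtheta_powr[OF assms(4)])
    show "eventually (\<lambda>k. real (b k) > 0) sequentially"
      using eventually_ge_at_top[of 1]
    proof eventually_elim
      case (elim k)
      with assms(3)[of k] show ?case by simp
    qed
  qed
  \<comment> \<open>The finite bounds use the actual exponent \<open>u k\<close> rather than its
    limit, and the maximum is continuous, so no case distinction on the position of \<beta> relative
    to 1 / 2 arises.\<close>
  then have m: "(\<lambda>k. max (2 - u k) (1 + u k)) \<longlonglongrightarrow> max (2 - \<beta>) (1 + \<beta>)"
    by (intro tendsto_intros)
  have lower: "(\<lambda>k. max (2 - u k) (1 + u k) - ln 8 / ln (real k)) \<longlonglongrightarrow> max (2 - \<beta>) (1 + \<beta>)"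
    using tendsto_diff[OF m tendsto_const_over_ln[of "ln 8"]] by simp
  have upper: "(\<lambda>k. max (2 - u k) (1 + u k) + ln 3 / ln (real k)) \<longlonglongrightarrow> max (2 - \<beta>) (1 + \<beta>)"
    using tendsto_add[OF m tendsto_const_over_ln[of "ln 3"]] by simp
  have lim: "log_ratio T \<longlonglongrightarrow> max (2 - \<beta>) (1 + \<beta>)"
  proof (rule tendsto_sandwich[OF _ _ lower upper])
    show "eventually (\<lambda>k. max (2 - u k) (1 + u k) - ln 8 / ln (real k) \<le> log_ratio T k) sequentially"
      using eventually_ge_at_top[of 2]
    proof eventually_elim
      case (elim k)
      with assms(3,5)[of k] show ?case
        unfolding u_def by (intro log_ratio_two_stage_tree_bounds) auto
    qed
    show "eventually (\<lambda>k. log_ratio T k \<le> max (2 - u k) (1 + u k) + ln 3 / ln (real k)) sequentially"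
      using eventually_ge_at_top[of 2]
    proof eventually_elim
      case (elim k)
      with assms(3,5)[of k] show ?case
        unfolding u_def by (intro log_ratio_two_stage_tree_bounds) auto
    qed
  qed
  then have exponent: "tree_exponent T = 1 / 2 * max (2 - \<beta>) (1 + \<beta>)"
    by (simp add: tree_exponent_def limI)
  have "(\<lambda>k. real (b k)) \<in> \<Theta>(\<lambda>k. sqrt (real k))" if "\<beta> = 1 / 2"
    using assms(4) that by (simp add: powr_half_sqrt)
  with lim exponent show ?thesis
    by (auto simp: convergent_def)
qed

end
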